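(* Let $K\ge 1$ and, for $k=1,2,\ldots,K$, let $\mathcal{M}_k$ be a nonempty finite index set. Let $\mathbf{A}_i=\mathbf{F}^{\mathrm H}\mathbf{P}\mathbf{C}_i\in\mathbb{C}^{m\times n}$, $i\in\bigcup_k\mathcal{M}_k$, be the Fourier ptychographic measurement matrices described in the context (with $\mathbf{P}\neq 0$). For $k=1,\ldots,K$ let $\mathbf{y}_{\mathcal{M}_k}\in\mathbb{R}^m_{\ge 0}$ be the $k$th multiplexed measurement, i.e. for some (unknown) $\mathbf{s}^{\natural}\in\mathbb{C}^n$, $$\mathbf{y}_{\mathcal{M}_k}=\sqrt{\sum_{i\in\mathcal{M}_k}|\mathbf{A}_i\mathbf{s}^{\natural}|^2},\qquad k=1,\ldots,K,$$ with $|\cdot|^2$ and $\sqrt{\cdot}$ acting entrywise. Define $$\mathcal{J}(\mathbf{s})=\sum_{k=1}^K\left\|\mathbf{y}_{\mathcal{M}_k}-\sqrt{\sum_{i\in\mathcal{M}_k}|\mathbf{A}_i\mathbf{s}|^2}\right\|_2^2,\qquad \mathbf{s}\in\mathbb{C}^n,$$ let $\nabla\mathcal{J}$ be its generalized (Wirtinger) gradient as defined in the context, and let $$\mu=\frac{1}{\left\|\sum_{k=1}^K\sum_{i\in\mathcal{M}_k}\mathbf{C}_i^{\mathrm H}\mathbf{P}^{\mathrm H}\mathbf{P}\mathbf{C}_i\right\|_2},$$ where $\|\cdot\|_2$ of a matrix is the spectral norm. Starting from any $\mathbf{s}_1\in\mathbb{C}^n$, let $$\mathbf{s}_{t+1}=\mathbf{s}_t-\mu\,\nabla\mathcal{J}(\mathbf{s}_t),\qquad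 t=1,2,\ldots$$ Let $\mathbf{s}_*\in\arg\min_{\mathbf{s}\in\mathbb{C}^n}\mathcal{J}(\mathbf{s})$ be a global minimizer. Then $$\lim_{t\to\infty}\|\nabla\mathcal{J}(\mathbf{s}_t)\|_2=0,$$ and, for every integer $T\ge 1$, $$\min_{t\in\{1,2,\ldots,T\}}\|\nabla\mathcal{J}(\mathbf{s}_t)\|_2^2\le\frac{\mathcal{J}(\mathbf{s}_1)-\mathcal{J}(\mathbf{s}_* )}{\mu T}.$$
   Context: Matrices. Let $m<n$ be positive integers. $\mathbf{F}\in\mathbb{C}^{m\times m}$ is the normalized (unitary) discrete Fourier transform matrix of an $m$-pixel two-dimensional image, and $\mathbf{F}^{\mathrm H}$ is its conjugate transpose (equal to its inverse). $\mathbf{P}\in\mathbb{C}^{m\times m}$ is a diagonal matrix (the discretized pupil function). For each index (LED) $i$, $\mathbf{C}_i\in\mathbb{C}^{m\times n}$ is a cropping matrix: it selects $m$ of the $n$ coordinates (an $m$-pixel window centered at a spatial frequency $\boldsymbol{\xi}_i$), i.e. each row has exactly one entry equal to $1$ and all others $0$, and distinct rows select distinct coordinates. $\mathbf{A}_i=\mathbf{F}^{\mathrm H}\mathbf{P}\mathbf{C}_i$. The superscript $\mathrm H$ denotes conjugate transpose. Generalized gradient. At a point $\mathbf{s}\in\mathbb{C}^n$ for which every entry of $\sqrt{\sum_{i\in\mathcal{M}_k}|\mathbf{A}_i\mathbf{s}|^2}$ is nonzero for all $k$, $$\nabla\mathcal{J}(\mathbf{s})=\sum_{k=1}^K\sum_{i\in\mathcal{M}_k}\mathbf{C}_i^{\mathrm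 H}\mathbf{P}^{\mathrm H}\mathbf{F}\,\mathbf{e}_{k,i},\qquad \mathbf{e}_{k,i}=\left(\sqrt{\sum_{l\in\mathcal{M}_k}|\mathbf{A}_l\mathbf{s}|^2}-\mathbf{y}_{\mathcal{M}_k}\right)\odot\left(\frac{\mathbf{A}_i\mathbf{s}}{\sqrt{\sum_{l\in\mathcal{M}_k}|\mathbf{A}_l\mathbf{s}|^2}}\right),$$ where $\odot$ is the entrywise product and the division is entrywise. (This is the Wirtinger gradient of $\mathcal{J}$, i.e. the derivative with respect to $\overline{\mathbf{s}}$.) At any other point $\mathbf{s}$, $\nabla\mathcal{J}(\mathbf{s})$ denotes one (arbitrarily chosen) limit point of $\nabla\mathcal{J}(\mathbf{s}')$ as $\mathbf{s}'\to\mathbf{s}$ through points $\mathbf{s}'$ at which the displayed formula applies. *)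

theory Defs
  imports "HOL-Analysis.Analysis"
begin

definition conj_transpose :: "complex ^ 'n ^ 'm \<Rightarrow> complex ^ 'm ^ 'n" where
  "conj_transpose A = (\<chi> i j. cnj (A $ j $ i))"

definition is_diagonal :: "complex ^ 'm ^ 'm \<Rightarrow> bool" where
  "is_diagonal P \<longleftrightarrow> (\<forall>i j. i \<noteq> j \<longrightarrow> P $ i $ j = 0)"

definition is_cropping :: "complex ^ 'n ^ 'm \<Rightarrow> bool" where
  "is_cropping C \<longleftrightarrow>
     (\<exists>\<sigma> :: 'm \<Rightarrow> 'n. inj \<sigma> \<and> (\<forall>i j. C $ i $ j = (if j = \<sigma> i then 1 else 0)))"

definition spectral_norm :: "complex ^ 'n ^ 'm \<Rightarrow> real" where
  "spectral_norm A = onorm (\<lambda>x. A *v x)"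

(* The image is an m1 by m2 grid of pixels and 'm indexes its vectorization: pix p gives
   the (row, column) of the entry p, so it has to be a bijection onto {..<m1} \<times> {..<m2}. *)
definition dft2 :: "nat \<Rightarrow> nat \<Rightarrow> ('m \<Rightarrow> nat \<times> nat) \<Rightarrow> complex ^ 'm ^ 'm" where
  "dft2 m1 m2 pix =
     (\<chi> p q. cis (- 2 * pi * (real (fst (pix p) * fst (pix q)) / real m1
                              + real (snd (pix p) * snd (pix q)) / real m2))
             / complex_of_real (sqrt (real (m1 * m2))))"

definition amplitude :: "('i \<Rightarrow> complex ^ 'n ^ 'm) \<Rightarrow> 'i set \<Rightarrow> complex ^ 'n \<Rightarrow> real ^ 'm" where
  "amplitude A M s = (\<chi> j. sqrt (\<Sum>i\<in>M. (cmod ((A i *v s) $ j))\<^sup>2))"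

definition loss ::
  "('i \<Rightarrow> complex ^ 'n ^ 'm) \<Rightarrow> nat \<Rightarrow> (nat \<Rightarrow> 'i set) \<Rightarrow> (nat \<Rightarrow> real ^ 'm) \<Rightarrow> complex ^ 'n \<Rightarrow> real" where
  "loss A K M y s = (\<Sum>k=1..K. (norm (y k - amplitude A (M k) s))\<^sup>2)"

definition regular_point ::
  "('i \<Rightarrow> complex ^ 'n ^ 'm) \<Rightarrow> nat \<Rightarrow> (nat \<Rightarrow> 'i set) \<Rightarrow> complex ^ 'n \<Rightarrow> bool" where
  "regular_point A K M s \<longleftrightarrow> (\<forall>k\<in>{1..K}. \<forall>j. amplitude A (M k) s $ j \<noteq> 0)"

definition residual ::
  "('i \<Rightarrow> complex ^ 'n ^ 'm) \<Rightarrow> 'i set \<Rightarrow> real ^ 'm \<Rightarrow> complex ^ 'n \<Rightarrow> 'i \<Rightarrow> complex ^ 'm" where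
  "residual A M y s i =
     (\<chi> j. complex_of_real (amplitude A M s $ j - y $ j)
           * ((A i *v s) $ j / complex_of_real (amplitude A M s $ j)))"

definition fp_matrix ::
  "complex ^ 'm ^ 'm \<Rightarrow> complex ^ 'm ^ 'm \<Rightarrow> ('i \<Rightarrow> complex ^ 'n ^ 'm) \<Rightarrow> 'i \<Rightarrow> complex ^ 'n ^ 'm" where
  "fp_matrix F P C i = conj_transpose F ** P ** C i"

definition gradient_formula ::
  "complex ^ 'm ^ 'm \<Rightarrow> complex ^ 'm ^ 'm \<Rightarrow> ('i \<Rightarrow> complex ^ 'n ^ 'm) \<Rightarrow> nat
     \<Rightarrow> (nat \<Rightarrow> 'i set) \<Rightarrow> (nat \<Rightarrow> real ^ 'm) \<Rightarrow> complex ^ 'n \<Rightarrow> complex ^ 'n" where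
  "gradient_formula F P C K M y s =
     (\<Sum>k=1..K. \<Sum>i\<in>M k.
        (conj_transpose (C i) ** conj_transpose P ** F) *v residual (fp_matrix F P C) (M k) (y k) s i)"

(* Off the regular points the value is any limit point of the formula, so the generalized
   gradient is not unique: this is a predicate on functions G. *)
definition is_generalized_gradient ::
  "complex ^ 'm ^ 'm \<Rightarrow> complex ^ 'm ^ 'm \<Rightarrow> ('i \<Rightarrow> complex ^ 'n ^ 'm) \<Rightarrow> nat
     \<Rightarrow> (nat \<Rightarrow> 'i set) \<Rightarrow> (nat \<Rightarrow> real ^ 'm) \<Rightarrow> (complex ^ 'n \<Rightarrow> complex ^ 'n) \<Rightarrow> bool" where
  "is_generalized_gradient F P C K M y G \<longleftrightarrow>
     (\<forall>s. if regular_point (fp_matrix F P C) K M s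
          then G s = gradient_formula F P C K M y s
          else (\<exists>\<sigma> :: nat \<Rightarrow> complex ^ 'n.
                  (\<forall>l. regular_point (fp_matrix F P C) K M (\<sigma> l)) \<and> \<sigma> \<longlonglongrightarrow> s \<and>
                  (\<lambda>l. gradient_formula F P C K M y (\<sigma> l)) \<longlonglongrightarrow> G s))"

end

theory Submission
  imports Defs
begin

text \<open>
  Where the amplitudes a = N(v), v = (A_l s)_l, do not vanish, the loss is majorized by a quadratic:
  since y \<ge> 0, the reverse triangle inequality gives
  (y - N(w))^2 \<le> \<parallel>w - (y / a) v\<parallel>^2, with equality at w = v, and the right-hand side is an
  exact quadratic in w - v whose linear part is the Wirtinger gradient. As F is unitary, summing up gives
  J(z) \<le> J(s) + 2 \<langle>g, z - s\<rangle> + \<langle>z - s, H (z - s)\<rangle> with g the gradient at s and H the matrix in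
  the definition of \<mu>, first at regular points and, by continuity of J, at all points. For z = s - \<mu> g
  this reads J(z) \<le> J(s) - \<mu> \<parallel>g\<parallel>^2, and telescoping finishes the proof.
\<close>

subsection \<open>Complex matrices and the real inner product\<close>

lemma conj_transpose_mult: "conj_transpose (A ** B) = conj_transpose B ** conj_transpose A"
  by (simp add: conj_transpose_def matrix_matrix_mult_def vec_eq_iff mult.commute)

lemma conj_transpose_conj_transpose [simp]: "conj_transpose (conj_transpose A) = A"
  by (simp add: conj_transpose_def vec_eq_iff)

lemma inner_complex_mult_left: "inner (cnj a * x) y = inner x (a * (y::complex))"
  by (simp add: inner_complex_def algebra_simps)

text \<open>\<open>inner\<close> on complex vectors is the real part of the Hermitian product, so
  the adjoint is still the conjugate transpose. The real part is all that the linear term of the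
  majorant involves.\<close>

lemma inner_conj_transpose: "inner (conj_transpose A *v x) y = inner x (A *v y)"
proof -
  have "inner (conj_transpose A *v x) y = (\<Sum>j\<in>UNIV. \<Sum>i\<in>UNIV. inner (cnj (A $ i $ j) * x $ i) (y $ j))"
    by (simp add: inner_vec_def matrix_vector_mult_def conj_transpose_def inner_sum_left)
  also have "\<dots> = (\<Sum>i\<in>UNIV. \<Sum>j\<in>UNIV. inner (x $ i) (A $ i $ j * y $ j))"
    by (subst sum.swap) (simp add: inner_complex_mult_left)
  also have "\<dots> = inner x (A *v y)"
    by (simp add: inner_vec_def matrix_vector_mult_def inner_sum_right)
  finally show ?thesis .
qed

lemma norm_unitary_mult:
  assumes "conj_transpose A ** A = mat 1"
  shows "norm (A *v x) = norm x"
proof -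
  have "inner (A *v x) (A *v x) = inner (conj_transpose A *v (A *v x)) x"
    by (simp add: inner_conj_transpose)
  also have "\<dots> = inner x x"
    by (simp add: assms matrix_vector_mul_assoc)
  finally show ?thesis by (simp add: norm_eq_sqrt_inner)
qed

lemma sum_matrix_vector_mult: "(\<Sum>i\<in>I. A i) *v x = (\<Sum>i\<in>I. A i *v x)"
  by (induction I rule: infinite_finite_induct) (simp_all add: matrix_vector_mult_add_rdistrib)

text \<open>Cauchy-Schwarz and the operator norm bound. This is how the constant in \<mu> controls
  the curvature of the majorant.\<close>

lemma inner_matrix_le_spectral_norm: "inner x (H *v x) \<le> spectral_norm H * (norm x)\<^sup>2"
proof -
  have "inner x (H *v x) \<le> norm x * norm (H *v x)"
    by (rule norm_cauchy_schwarz)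
  also have "\<dots> \<le> norm x * (spectral_norm H * norm x)"
    unfolding spectral_norm_def
    by (intro mult_left_mono onorm matrix_vector_mul_bounded_linear norm_ge_zero)
  finally show ?thesis by (simp add: power2_eq_square mult_ac)
qed

subsection \<open>Unitarity of the discrete Fourier transform\<close>

text \<open>A geometric sum over powers of an N-th root of unity \<open>z\<close>. For 0 < |k| < N
  the number N does not divide k, so \<open>z\<close> is not 1 and the sum vanishes.\<close>

lemma sum_cis_roots_of_unity:
  fixes k :: int and N :: nat
  assumes "\<bar>k\<bar> < int N"
  shows "(\<Sum>a<N. cis (2 * pi * (real_of_int k * real a / real N))) = (if k = 0 then of_nat N else 0)"
proof (cases "k = 0")
  case False
  define z where "z = cis (2 * pi * real_of_int k / real N)"
  have N: "N > 0" using assms by linarith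
  have "z \<noteq> 1"
  proof
    assume "z = 1"
    then have "cos (2 * pi * real_of_int k / real N) = 1"
      by (metis z_def cis.sel(1) one_complex.sel(1))
    then obtain l :: int where "2 * pi * real_of_int k / real N = l * 2 * pi"
      by (auto simp: cos_one_2pi_int)
    then have "real_of_int k = real_of_int (l * int N)" using N by (simp add: field_simps)
    then have "k = l * int N" by (simp only: of_int_eq_iff)
    with False assms show False
      by (metis dvd_triv_right dvd_imp_le_int linorder_not_le of_nat_0_le_iff abs_of_nat)
  qed
  moreover have "z ^ N = 1"
  proof -
    have "real N * (2 * pi * real_of_int k / real N) = 2 * pi * real_of_int k" using N by simp
    then have "z ^ N = cis (2 * pi * real_of_int k)" by (simp only: z_def Complex.DeMoivre)
    then show ?thesis by (simp add: cis_multiple_2pi)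
  qed
  ultimately have "(\<Sum>a<N. z ^ a) = 0"
    by (simp add: geometric_sum)
  then show ?thesis using False
    by (simp add: z_def Complex.DeMoivre mult_ac)
qed simp

text \<open>Orthonormality of the rows: reindexing by \<open>pix\<close> turns the product of two
  rows into a double sum over the grid, which factors into two one-dimensional sums of roots of
  unity.\<close>

lemma dft2_unitary:
  fixes pix :: "'m::finite \<Rightarrow> nat \<times> nat"
  assumes pix: "bij_betw pix UNIV ({..<m1} \<times> {..<m2})"
  shows "dft2 m1 m2 pix ** conj_transpose (dft2 m1 m2 pix) = mat 1"
proof -
  let ?F = "dft2 m1 m2 pix"
  have range: "fst (pix p) < m1" "snd (pix p) < m2" for p
    using bij_betwE[OF pix] by (auto simp: mem_Times_iff)
  have entry: "(\<Sum>r\<in>UNIV. ?F $ p $ r * cnj (?F $ q $ r)) = (if p = q then 1 else 0)" for p q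
  proof -
    \<comment> \<open>The exponent in \<open>dft2\<close> is negative and row \<open>q\<close> is
      conjugated, so the surviving frequency is that of \<open>q\<close> minus that of
      \<open>p\<close>. Both indices lie in the grid, which keeps |k1| < m1 and |k2| < m2.\<close>
    define k1 where "k1 = int (fst (pix q)) - int (fst (pix p))"
    define k2 where "k2 = int (snd (pix q)) - int (snd (pix p))"
    define f where "f k N a = cis (2 * pi * (real_of_int k * real a / real N))" for k and N a :: nat
    have m: "m1 > 0" "m2 > 0" using range[of p] by auto
    have k0: "k1 = 0 \<and> k2 = 0 \<longleftrightarrow> p = q"
      using bij_betw_imp_inj_on[OF pix] by (auto simp: k1_def k2_def prod_eq_iff inj_def)
    have "?F $ p $ r * cnj (?F $ q $ r)
        = f k1 m1 (fst (pix r)) * f k2 m2 (snd (pix r)) / of_nat (m1 * m2)" for r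
    proof -
      have "complex_of_real (sqrt (real (m1 * m2))) * complex_of_real (sqrt (real (m1 * m2)))
          = of_nat (m1 * m2)"
        by (metis of_real_mult of_real_of_nat_eq of_nat_0_le_iff real_sqrt_mult_self abs_of_nat)
      then show ?thesis
        by (simp add: dft2_def f_def cis_mult cis_cnj k1_def k2_def del: of_nat_mult)
           (simp add: algebra_simps add_divide_distrib diff_divide_distrib)
    qed
    then have "(\<Sum>r\<in>UNIV. ?F $ p $ r * cnj (?F $ q $ r))
        = (\<Sum>r\<in>UNIV. (\<lambda>(a, b). f k1 m1 a * f k2 m2 b / of_nat (m1 * m2)) (pix r))"
      by (simp add: case_prod_beta)
    also have "\<dots> = (\<Sum>(a, b)\<in>{..<m1} \<times> {..<m2}. f k1 m1 a * f k2 m2 b / of_nat (m1 * m2))"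
      by (rule sum.reindex_bij_betw[OF pix])
    also have "\<dots> = (\<Sum>a<m1. f k1 m1 a) * (\<Sum>b<m2. f k2 m2 b) / of_nat (m1 * m2)"
      by (simp add: sum_product sum.cartesian_product sum_divide_distrib case_prod_beta)
    also have "\<dots> = (if k1 = 0 then of_nat m1 else 0) * (if k2 = 0 then of_nat m2 else 0) / of_nat (m1 * m2)"
    proof -
      have "\<bar>k1\<bar> < int m1" "\<bar>k2\<bar> < int m2"
        using range[of p] range[of q] by (auto simp: k1_def k2_def)
      then show ?thesis unfolding f_def by (simp only: sum_cis_roots_of_unity)
    qed
    also have "\<dots> = (if p = q then 1 else 0)"
      using m k0 by auto
    finally show ?thesis .
  qed
  show ?thesis
    by (simp add: vec_eq_iff matrix_matrix_mult_def conj_transpose_def mat_def entry)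
qed

subsection \<open>Quadratic majorization of the loss\<close>

lemma amplitude_nth: "amplitude A M s $ j = L2_set (\<lambda>i. norm ((A i *v s) $ j)) M"
  by (simp add: amplitude_def L2_set_def)

text \<open>Cauchy-Schwarz for the families \<open>v\<close> and \<open>w\<close> gives S / a \<le>
  b; multiplying by y \<ge> 0 keeps the direction, and this is the only inequality involved.\<close>

lemma L2_majorization:
  fixes v w :: "'i \<Rightarrow> 'a::real_inner"
  assumes "y \<ge> 0" and a: "a = L2_set (\<lambda>i. norm (v i)) M" and "a \<noteq> 0"
  shows "(y - L2_set (\<lambda>i. norm (w i)) M)\<^sup>2
    \<le> (y - a)\<^sup>2 + 2 * (\<Sum>i\<in>M. inner (((a - y) / a) *\<^sub>R v i) (w i - v i)) + (\<Sum>i\<in>M. (norm (w i - v i))\<^sup>2)"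
proof -
  define b where "b = L2_set (\<lambda>i. norm (w i)) M"
  define S where "S = (\<Sum>i\<in>M. inner (v i) (w i))"
  have a2: "(\<Sum>i\<in>M. inner (v i) (v i)) = a\<^sup>2" and b2: "(\<Sum>i\<in>M. inner (w i) (w i)) = b\<^sup>2"
    by (simp_all add: a b_def L2_set_def sum_nonneg power2_norm_eq_inner)
  have "S \<le> (\<Sum>i\<in>M. \<bar>norm (v i)\<bar> * \<bar>norm (w i)\<bar>)"
    unfolding S_def by (intro sum_mono) (simp add: norm_cauchy_schwarz)
  also have "\<dots> \<le> a * b"
    unfolding a b_def by (rule L2_set_mult_ineq)
  finally have "S \<le> a * b" .
  moreover have a0: "a > 0" using \<open>a \<noteq> 0\<close> by (simp add: a less_le)
  ultimately have "S / a \<le> b" by (simp add: pos_divide_le_eq mult.commute)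
  then have yS: "y * S / a \<le> y * b"
    using mult_left_mono[OF _ \<open>y \<ge> 0\<close>] by fastforce
  have "(\<Sum>i\<in>M. inner (((a - y) / a) *\<^sub>R v i) (w i - v i)) = (a - y) / a * (S - a\<^sup>2)"
    by (simp add: S_def inner_diff_right sum_subtractf right_diff_distrib
      diff_divide_distrib flip: a2 sum_distrib_left sum_divide_distrib)
  moreover have "\<dots> = S - a\<^sup>2 - y * S / a + y * a"
    using a0 by (simp add: field_simps power2_eq_square)
  moreover have "(\<Sum>i\<in>M. (norm (w i - v i))\<^sup>2) = b\<^sup>2 - 2 * S + a\<^sup>2"
    by (simp add: S_def power2_norm_eq_inner inner_diff inner_commute[of "w _" "v _"]
      sum_subtractf sum.distrib a2 b2 algebra_simps flip: sum_distrib_left)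
  \<comment> \<open>The right-hand side collapses to y^2 - 2 y S / a + b^2, to be compared with y^2
    - 2 y b + b^2, so the claim is exactly \<open>yS\<close>.\<close>
  ultimately show ?thesis
    using yS unfolding b_def[symmetric] by (simp add: power2_diff)
qed

lemma norm_vec_power2: "(norm x)\<^sup>2 = (\<Sum>j\<in>UNIV. (norm (x $ j))\<^sup>2)"
  for x :: "'a::real_inner ^ 'n"
  by (simp add: power2_norm_eq_inner inner_vec_def)

text \<open>The scalar majorization is applied at each pixel \<open>j\<close> to the family of
  values (A_i s)_j indexed by the LEDs \<open>i\<close> in \<open>M\<close>; \<open>res\<close> puts
  the residual into the required form of a real multiple. Swapping the sums over pixels and LEDs
  then reassembles whole vectors.\<close>

lemma amplitude_majorization:
  assumes y: "\<And>j. y $ j \<ge> 0" and reg: "\<And>j. amplitude A M s $ j \<noteq> 0"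
  shows "(norm (y - amplitude A M z))\<^sup>2 \<le> (norm (y - amplitude A M s))\<^sup>2
    + 2 * (\<Sum>i\<in>M. inner (residual A M y s i) (A i *v (z - s))) + (\<Sum>i\<in>M. (norm (A i *v (z - s)))\<^sup>2)"
proof -
  let ?a = "amplitude A M"
  have res: "residual A M y s i $ j = ((?a s $ j - y $ j) / ?a s $ j) *\<^sub>R (A i *v s) $ j" for i j
    by (simp add: residual_def scaleR_conv_of_real)
  have "(norm (y - ?a z))\<^sup>2 = (\<Sum>j\<in>UNIV. (y $ j - ?a z $ j)\<^sup>2)"
    by (simp add: norm_vec_power2)
  also have "\<dots> \<le> (\<Sum>j\<in>UNIV. (y $ j - ?a s $ j)\<^sup>2
      + 2 * (\<Sum>i\<in>M. inner (residual A M y s i $ j) ((A i *v z) $ j - (A i *v s) $ j))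
      + (\<Sum>i\<in>M. (norm ((A i *v z) $ j - (A i *v s) $ j))\<^sup>2))"
  proof (rule sum_mono)
    fix j
    show "(y $ j - ?a z $ j)\<^sup>2 \<le> (y $ j - ?a s $ j)\<^sup>2
      + 2 * (\<Sum>i\<in>M. inner (residual A M y s i $ j) ((A i *v z) $ j - (A i *v s) $ j))
      + (\<Sum>i\<in>M. (norm ((A i *v z) $ j - (A i *v s) $ j))\<^sup>2)"
      unfolding res amplitude_nth[of A M z]
      by (rule L2_majorization[OF y amplitude_nth reg])
  qed
  also have "\<dots> = (norm (y - ?a s))\<^sup>2
      + 2 * (\<Sum>j\<in>UNIV. \<Sum>i\<in>M. inner (residual A M y s i $ j) ((A i *v (z - s)) $ j))
      + (\<Sum>j\<in>UNIV. \<Sum>i\<in>M. (norm ((A i *v (z - s)) $ j))\<^sup>2)"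
    by (simp add: norm_vec_power2[of "y - ?a s"] sum.distrib sum_distrib_left
      matrix_vector_mult_diff_distrib)
  also have "\<dots> = (norm (y - ?a s))\<^sup>2
    + 2 * (\<Sum>i\<in>M. inner (residual A M y s i) (A i *v (z - s))) + (\<Sum>i\<in>M. (norm (A i *v (z - s)))\<^sup>2)"
    by (subst (1 2) sum.swap) (simp add: inner_vec_def[of "residual _ _ _ _ _"] norm_vec_power2[of "_ *v _"])
  finally show ?thesis .
qed

lemma inner_gradient_formula:
  "inner (gradient_formula F P C K M y s) d =
    (\<Sum>k=1..K. \<Sum>i\<in>M k. inner (residual (fp_matrix F P C) (M k) (y k) s i) (fp_matrix F P C i *v d))"
proof -
  have "conj_transpose (C i) ** conj_transpose P ** F = conj_transpose (fp_matrix F P C i)" for i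
    by (simp add: fp_matrix_def conj_transpose_mult matrix_mul_assoc)
  then show ?thesis
    by (simp add: gradient_formula_def inner_sum_left inner_conj_transpose)
qed

text \<open>Each summand is the Gram matrix of \<open>P ** C i\<close>, and the remaining factor
  \<open>conj_transpose F\<close> of the measurement matrix is an isometry. This identifies the
  quadratic term of the majorant with the matrix in \<mu>, where F does not appear.\<close>

lemma inner_normal_matrix:
  assumes "F ** conj_transpose F = mat 1"
  shows "inner d ((\<Sum>k=1..K. \<Sum>i\<in>M k. conj_transpose (C i) ** conj_transpose P ** P ** C i) *v d)
    = (\<Sum>k=1..K. \<Sum>i\<in>M k. (norm (fp_matrix F P C i *v d))\<^sup>2)"
proof -
  have "inner d ((conj_transpose (C i) ** conj_transpose P ** P ** C i) *v d)
      = (norm (fp_matrix F P C i *v d))\<^sup>2" for i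
  proof -
    have "(conj_transpose (C i) ** conj_transpose P ** P ** C i) *v d
        = conj_transpose (P ** C i) *v ((P ** C i) *v d)"
      by (simp add: conj_transpose_mult matrix_vector_mul_assoc matrix_mul_assoc)
    then have "inner d ((conj_transpose (C i) ** conj_transpose P ** P ** C i) *v d)
        = (norm ((P ** C i) *v d))\<^sup>2"
      by (simp add: inner_commute[of d] inner_conj_transpose power2_norm_eq_inner)
    moreover have "fp_matrix F P C i *v d = conj_transpose F *v ((P ** C i) *v d)"
      by (simp add: fp_matrix_def matrix_vector_mul_assoc matrix_mul_assoc)
    ultimately show ?thesis
      by (simp add: norm_unitary_mult assms)
  qed
  then show ?thesis
    by (simp add: sum_matrix_vector_mult inner_sum_right)
qed

lemma loss_majorization_regular:
  assumes "\<And>k j. k \<in> {1..K} \<Longrightarrow> y k $ j \<ge> 0"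
    and "regular_point (fp_matrix F P C) K M s"
  shows "loss (fp_matrix F P C) K M y z \<le> loss (fp_matrix F P C) K M y s
    + 2 * inner (gradient_formula F P C K M y s) (z - s)
    + (\<Sum>k=1..K. \<Sum>i\<in>M k. (norm (fp_matrix F P C i *v (z - s)))\<^sup>2)"
proof -
  let ?A = "fp_matrix F P C"
  have "loss ?A K M y z \<le> (\<Sum>k=1..K. (norm (y k - amplitude ?A (M k) s))\<^sup>2
    + 2 * (\<Sum>i\<in>M k. inner (residual ?A (M k) (y k) s i) (?A i *v (z - s)))
    + (\<Sum>i\<in>M k. (norm (?A i *v (z - s)))\<^sup>2))"
    unfolding loss_def
    using assms by (intro sum_mono amplitude_majorization) (auto simp: regular_point_def)
  then show ?thesis
    by (simp add: inner_gradient_formula loss_def sum.distrib sum_distrib_left)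
qed

lemma continuous_on_loss: "continuous_on UNIV (loss A K M y)"
proof -
  have "continuous_on UNIV (\<lambda>x. amplitude A N x)" for N
    unfolding amplitude_def matrix_vector_mult_def by (auto intro!: continuous_intros)
  then show ?thesis
    unfolding loss_def by (auto intro!: continuous_intros)
qed

text \<open>At a point that is not regular, the inequality holds along the regular sequence that
  defines \<open>G s\<close>. Both the loss and the quadratic term are continuous, and the gradients
  converge to \<open>G s\<close>, so it survives the limit.\<close>

lemma loss_majorization:
  assumes y: "\<And>k j. k \<in> {1..K} \<Longrightarrow> y k $ j \<ge> 0"
    and G: "is_generalized_gradient F P C K M y G"
  shows "loss (fp_matrix F P C) K M y z \<le> loss (fp_matrix F P C) K M y s
    + 2 * inner (G s) (z - s) + (\<Sum>k=1..K. \<Sum>i\<in>M k. (norm (fp_matrix F P C i *v (z - s)))\<^sup>2)"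
proof (cases "regular_point (fp_matrix F P C) K M s")
  case True
  then have "G s = gradient_formula F P C K M y s"
    using G unfolding is_generalized_gradient_def by presburger
  then show ?thesis
    using loss_majorization_regular[OF y True] by simp
next
  case False
  let ?A = "fp_matrix F P C"
  have "\<exists>\<sigma>. (\<forall>l. regular_point ?A K M (\<sigma> l)) \<and> \<sigma> \<longlonglongrightarrow> s \<and>
      (\<lambda>l. gradient_formula F P C K M y (\<sigma> l)) \<longlonglongrightarrow> G s"
    using False G unfolding is_generalized_gradient_def by presburger
  then obtain \<sigma> where reg: "\<And>l. regular_point ?A K M (\<sigma> l)" and lim: "\<sigma> \<longlonglongrightarrow> s"
    and limG: "(\<lambda>l. gradient_formula F P C K M y (\<sigma> l)) \<longlonglongrightarrow> G s"
    by blast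
  have "(\<lambda>l. loss ?A K M y (\<sigma> l)) \<longlonglongrightarrow> loss ?A K M y s"
    using continuous_on_tendsto_compose[OF continuous_on_loss lim] by simp
  moreover have "(\<lambda>l. ?A i *v (z - \<sigma> l)) \<longlonglongrightarrow> ?A i *v (z - s)" for i
    by (intro bounded_linear.tendsto[OF matrix_vector_mul_bounded_linear] tendsto_intros lim)
  ultimately have "(\<lambda>l. loss ?A K M y (\<sigma> l)
      + 2 * inner (gradient_formula F P C K M y (\<sigma> l)) (z - \<sigma> l)
      + (\<Sum>k=1..K. \<Sum>i\<in>M k. (norm (?A i *v (z - \<sigma> l)))\<^sup>2))
    \<longlonglongrightarrow> loss ?A K M y s + 2 * inner (G s) (z - s)
      + (\<Sum>k=1..K. \<Sum>i\<in>M k. (norm (?A i *v (z - s)))\<^sup>2)"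
    by (intro tendsto_intros lim limG)
  then show ?thesis
    using loss_majorization_regular[OF y reg] by (intro LIMSEQ_le_const) auto
qed

text \<open>Makes the step size meaningful: with spectral norm 0, division by zero would give \<mu>
  = 0. It suffices to find one vector on which the quadratic form is positive.\<close>

lemma spectral_norm_normal_matrix_pos:
  fixes F P :: "complex ^ 'm ^ 'm" and C :: "'i \<Rightarrow> complex ^ 'n ^ 'm" and K :: nat
  assumes P: "is_diagonal P" "P \<noteq> 0" and K: "K \<ge> 1"
    and M: "\<And>k. k \<in> {1..K} \<Longrightarrow> finite (M k) \<and> M k \<noteq> {}"
    and C: "\<And>i. i \<in> (\<Union>k\<in>{1..K}. M k) \<Longrightarrow> is_cropping (C i)"
    and F: "F ** conj_transpose F = mat 1"
  shows "spectral_norm (\<Sum>k=1..K. \<Sum>i\<in>M k. conj_transpose (C i) ** conj_transpose P ** P ** C i) > 0"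
proof -
  obtain p where p: "P $ p $ p \<noteq> 0"
    using P by (auto simp: is_diagonal_def vec_eq_iff) metis
  have "M 1 \<noteq> {}" using M[of 1] K by simp
  then obtain i where i: "i \<in> M 1" by blast
  then have "is_cropping (C i)" using K by (intro C UN_I[of 1]) auto
  then obtain \<sigma> where \<sigma>: "inj \<sigma>" "\<And>r j. C i $ r $ j = (if j = \<sigma> r then 1 else 0)"
    unfolding is_cropping_def by blast
  \<comment> \<open>The coordinate selected by row \<open>p\<close> of \<open>C i\<close>; since
    \<sigma> is injective, no other row selects it. Hence \<open>C i\<close> maps \<open>d\<close>
    to the p-th unit vector, and \<open>P\<close> keeps its p-th entry nonzero.\<close>
  define d :: "complex ^ 'n" where "d = axis (\<sigma> p) 1"
  have "C i *v d = axis p 1"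
    using \<sigma> by (auto simp: d_def vec_eq_iff matrix_vector_mult_def axis_def inj_eq if_distrib cong: if_cong)
  then have "(P ** C i) *v d = P *v axis p 1"
    by (simp flip: matrix_vector_mul_assoc)
  then have "((P ** C i) *v d) $ p = P $ p $ p"
    by (simp add: matrix_vector_mult_def axis_def if_distrib cong: if_cong)
  with p have "(P ** C i) *v d \<noteq> 0" by (metis zero_index)
  moreover have "fp_matrix F P C i *v d = conj_transpose F *v ((P ** C i) *v d)"
    by (simp add: fp_matrix_def matrix_vector_mul_assoc matrix_mul_assoc)
  ultimately have "norm (fp_matrix F P C i *v d) > 0"
    using norm_unitary_mult[of "conj_transpose F"] F by simp
  then have "0 < (norm (fp_matrix F P C i *v d))\<^sup>2" by simp
  also have "\<dots> \<le> (\<Sum>i\<in>M 1. (norm (fp_matrix F P C i *v d))\<^sup>2)"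
    using i M[of 1] K by (intro member_le_sum) simp_all
  also have "\<dots> \<le> (\<Sum>k=1..K. \<Sum>i\<in>M k. (norm (fp_matrix F P C i *v d))\<^sup>2)"
    using K by (intro member_le_sum[where f = "\<lambda>k. \<Sum>i\<in>M k. (norm (fp_matrix F P C i *v d))\<^sup>2"])
      (auto intro: sum_nonneg)
  also have "\<dots> \<le> spectral_norm (\<Sum>k=1..K. \<Sum>i\<in>M k.
      conj_transpose (C i) ** conj_transpose P ** P ** C i) * (norm d)\<^sup>2"
    unfolding inner_normal_matrix[OF F, symmetric] by (rule inner_matrix_le_spectral_norm)
  finally show ?thesis
    by (simp add: zero_less_mult_iff)
qed

subsection \<open>Convergence of descent methods\<close>

lemma sum_le_of_descent:
  fixes f g :: "nat \<Rightarrow> real"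
  assumes "\<And>t. t \<ge> 1 \<Longrightarrow> f (t + 1) \<le> f t - g t" and "\<And>t. t \<ge> 1 \<Longrightarrow> L \<le> f t"
  shows "(\<Sum>t=1..T. g t) \<le> f 1 - L"
proof -
  have "(\<Sum>t=1..T. g t) \<le> f 1 - f (T + 1)"
  proof (induction T)
    case (Suc T)
    then show ?case using assms(1)[of "Suc T"] by simp
  qed simp
  then show ?thesis using assms(2)[of "T + 1"] by simp
qed

text \<open>Bounded partial sums of nonnegative terms give a convergent series, whose terms tend to
  0. The sums start at 1, hence the shift by \<open>Suc\<close>; the value at 0 does not affect the
  limit.\<close>

lemma tendsto_zero_of_sums_bounded:
  fixes g :: "nat \<Rightarrow> real"
  assumes "\<And>t. g t \<ge> 0" and "\<And>T. (\<Sum>t=1..T. g t) \<le> B"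
  shows "g \<longlonglongrightarrow> 0"
proof -
  have "(\<Sum>t<T. g (Suc t)) \<le> B" for T
    using assms(2)[of T] by (simp add: sum.atLeast1_atMost_eq)
  then have "summable (\<lambda>t. g (Suc t))"
    using assms(1) by (intro summableI_nonneg_bounded) auto
  then show ?thesis
    using summable_LIMSEQ_zero summable_Suc_iff by blast
qed

text \<open>The minimum is at most the mean.\<close>

lemma Min_le_average:
  fixes g :: "nat \<Rightarrow> real"
  assumes "T \<ge> 1" and "(\<Sum>t=1..T. g t) \<le> B"
  shows "Min (g ` {1..T}) \<le> B / real T"
proof -
  have "real T * Min (g ` {1..T}) = (\<Sum>t=1..T. Min (g ` {1..T}))" by simp
  also have "\<dots> \<le> (\<Sum>t=1..T. g t)" by (intro sum_mono) auto
  finally show ?thesis using assms by (simp add: pos_le_divide_eq mult.commute)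
qed

theorem theorem1:
  fixes F P :: "complex ^ 'm ^ 'm"
    and C A :: "'i \<Rightarrow> complex ^ 'n ^ 'm"
    and m1 m2 K :: nat
    and pix :: "'m \<Rightarrow> nat \<times> nat"
    and M :: "nat \<Rightarrow> 'i set"
    and y :: "nat \<Rightarrow> real ^ 'm"
    and s_nat s_star :: "complex ^ 'n"
    and grad :: "complex ^ 'n \<Rightarrow> complex ^ 'n"
    and \<mu> :: real
    and s :: "nat \<Rightarrow> complex ^ 'n"
  assumes dims: "CARD('m) < CARD('n)"
    and pix: "bij_betw pix UNIV ({..<m1} \<times> {..<m2})"
    and F: "F = dft2 m1 m2 pix"
    and P: "is_diagonal P" "P \<noteq> 0"
    and K: "K \<ge> 1"
    and M: "\<And>k. k \<in> {1..K} \<Longrightarrow> finite (M k) \<and> M k \<noteq> {}"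
    and C: "\<And>i. i \<in> (\<Union>k\<in>{1..K}. M k) \<Longrightarrow> is_cropping (C i)"
    and A: "A = fp_matrix F P C"
    and y: "\<And>k. k \<in> {1..K} \<Longrightarrow> y k = amplitude A (M k) s_nat"
    and grad: "is_generalized_gradient F P C K M y grad"
    and \<mu>: "\<mu> = 1 / spectral_norm (\<Sum>k=1..K. \<Sum>i\<in>M k.
                  conj_transpose (C i) ** conj_transpose P ** P ** C i)"
    and step: "\<And>t. t \<ge> 1 \<Longrightarrow> s (t + 1) = s t - \<mu> *\<^sub>R grad (s t)"
    and minimizer: "is_arg_min (loss A K M y) (\<lambda>_. True) s_star"
  shows "(\<lambda>t. norm (grad (s t))) \<longlonglongrightarrow> 0 \<and>
         (\<forall>T\<ge>1. Min ((\<lambda>t. (norm (grad (s t)))\<^sup>2) ` {1..T})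
                   \<le> (loss A K M y (s 1) - loss A K M y s_star) / (\<mu> * real T))"
proof -
  let ?J = "loss A K M y"
  define H where "H = (\<Sum>k=1..K. \<Sum>i\<in>M k. conj_transpose (C i) ** conj_transpose P ** P ** C i)"
  have FF: "F ** conj_transpose F = mat 1"
    unfolding F by (rule dft2_unitary[OF pix])
  have H: "spectral_norm H > 0"
    unfolding H_def by (rule spectral_norm_normal_matrix_pos[OF P K M C FF])
  have \<mu>H: "\<mu> = 1 / spectral_norm H" by (simp add: \<mu> H_def)
  have \<mu>0: "\<mu> > 0" using H by (simp add: \<mu>H)
  \<comment> \<open>Measurements are amplitudes, hence square roots; this supplies the sign
    condition of the majorization.\<close>
  have y0: "y k $ j \<ge> 0" if "k \<in> {1..K}" for k j
    using y[OF that] by (simp add: amplitude_nth)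
  have descent: "?J (s (t + 1)) \<le> ?J (s t) - \<mu> * (norm (grad (s t)))\<^sup>2" if "t \<ge> 1" for t
  proof -
    let ?g = "grad (s t)"
    have d: "s (t + 1) - s t = - (\<mu> *\<^sub>R ?g)" using step[OF that] by simp
    have "?J (s (t + 1)) \<le> ?J (s t) + 2 * inner ?g (s (t + 1) - s t)
        + inner (s (t + 1) - s t) (H *v (s (t + 1) - s t))"
      using loss_majorization[OF y0 grad]
      unfolding A H_def inner_normal_matrix[OF FF] by blast
    also have "\<dots> \<le> ?J (s t) + 2 * inner ?g (s (t + 1) - s t)
        + spectral_norm H * (norm (s (t + 1) - s t))\<^sup>2"
      by (intro add_left_mono inner_matrix_le_spectral_norm)
    also have "\<dots> = ?J (s t) - 2 * \<mu> * (norm ?g)\<^sup>2 + spectral_norm H * \<mu>\<^sup>2 * (norm ?g)\<^sup>2"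
      unfolding d by (simp add: power2_norm_eq_inner[symmetric] power_mult_distrib)
    \<comment> \<open>By the choice of \<mu> the quadratic term takes back at most half of the
      first-order decrease 2 \<mu> |g|^2, which leaves a net decrease of at least \<mu>
      |g|^2.\<close>
    also have "spectral_norm H * \<mu>\<^sup>2 = \<mu>"
      using H by (simp add: \<mu>H power2_eq_square)
    finally show ?thesis by simp
  qed
  \<comment> \<open>The minimal value bounds the loss below along all iterates, so the telescoped
    decreases have a bound independent of \<open>T\<close>.\<close>
  have "?J s_star \<le> ?J x" for x
    using minimizer by (auto simp: is_arg_min_def not_less)
  then have "\<mu> * (\<Sum>t=1..T. (norm (grad (s t)))\<^sup>2) \<le> ?J (s 1) - ?J s_star" for T
    unfolding sum_distrib_left by (intro sum_le_of_descent[of "\<lambda>t. ?J (s t)"] descent)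
  then have bound: "(\<Sum>t=1..T. (norm (grad (s t)))\<^sup>2) \<le> (?J (s 1) - ?J s_star) / \<mu>" for T
    using \<mu>0 by (simp add: pos_le_divide_eq mult.commute)
  have "(\<lambda>t. (norm (grad (s t)))\<^sup>2) \<longlonglongrightarrow> 0"
    by (rule tendsto_zero_of_sums_bounded[OF _ bound]) simp
  then have "(\<lambda>t. norm (grad (s t))) \<longlonglongrightarrow> 0"
    by simp
  moreover have "Min ((\<lambda>t. (norm (grad (s t)))\<^sup>2) ` {1..T}) \<le> (?J (s 1) - ?J s_star) / (\<mu> * real T)"
    if "T \<ge> 1" for T
    using Min_le_average[OF that bound] by simp
  ultimately show ?thesis by blast
qed

end
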